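(* If $|\mathcal{G}|>1$, then the two-stage Nash equilibrium in the market with a real-time MPM policy uniquely exists and is given by \begin{align*} &g_j^d=0,\qquad g_j^r=\frac{c_j^{-1}}{\sum_{k\in\mathcal{G}}c_k^{-1}}\,d,\qquad \beta_j^d=\frac{b^d}{\sum_{k\in\mathcal{G}}c_k^{-1}}\,d,\quad\forall j\in\mathcal{G},\\ &d_l^d=0,\qquad d_l^r=d_l,\quad\forall l\in\mathcal{L},\\ &\lambda^d=\lambda^r=\frac{d}{\sum_{k\in\mathcal{G}}c_k^{-1}}. \end{align*}
   Context: Market: $\mathcal{G}$ (generators) and $\mathcal{L}$ (loads) are finite nonempty sets. Generator $j$ has cost $\frac{c_j}{2}g_j^2$, $c_j>0$, for total dispatch $g_j=g_j^d+g_j^r$ (day-ahead plus real-time dispatch, real numbers). Load $l$ has fixed inelastic demand $d_l>0$ split as $d_l=d_l^d+d_l^r$ with $d_l^d,d_l^r\in\mathbb{R}$; $d:=\sum_l d_l$. Day-ahead market: with fixed slope $b^d>0$, generator $j$ bids $\beta_j^d\in\mathbb{R}$, meaning $g_j^d=b^d\lambda^d-\beta_j^d$; load $l$ bids $d_l^d\in\mathbb{R}$; the price is determined by clearing $\sum_j(b^d\lambda^d-\beta_j^d)=\sum_ld_l^d$. Real-time MPM (market power mitigation) policy: in real time, generator bids are replaced by true costs, so $g_j^r=c_j^{-1}\lambda^r-g_j^d$ for all $j$, and by power balance $\lambda^r=d/\sum_{k\in\mathcal{G}}c_k^{-1}$. Also $d_l^r=d_l-d_l^d$. Profit of generator $j$: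 $\pi_j=\lambda^rg_j^r+\lambda^dg_j^d-\frac{c_j}{2}(g_j^d+g_j^r)^2$. Payment of load $l$: $\rho_l=\lambda^dd_l^d+\lambda^r(d_l-d_l^d)$. Nash equilibrium (price-anticipating participants): with the real-time outcome given by the policy rule, all generators (choosing $\beta_j^d$) and all loads (choosing $d_l^d$) act simultaneously in the day-ahead market; each generator maximizes $\pi_j$ and each load minimizes $\rho_l$ given the other participants' bids, anticipating the effect of its own bid on the day-ahead clearing price $\lambda^d=\dfrac{\sum_ld_l^d+\sum_k\beta_k^d}{b^d|\mathcal{G}|}$. *)

theory Defs
  imports Complex_Main "HOL-Library.Cardinality"
begin

text \<open>
  Generators and loads are the elements of finite (hence nonempty) types \<open>'g\<close> and \<open>'l\<close>.
  A strategy profile consists of the intercepts \<open>\<beta>\<^sub>j\<^sup>d\<close> bid by the generators and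
  the day-ahead demands \<open>d\<^sub>l\<^sup>d\<close> bid by the loads. Throughout, \<open>b\<close> is the day-ahead
  slope \<open>b\<^sup>d\<close>, \<open>c\<close> the cost coefficients and \<open>d\<close> the inelastic demands.
\<close>

record ('g, 'l) bids =
  gen_bid :: "'g \<Rightarrow> real"
  load_bid :: "'l \<Rightarrow> real"

definition da_supply :: "real \<Rightarrow> ('g, 'l) bids \<Rightarrow> real \<Rightarrow> 'g \<Rightarrow> real" where
  "da_supply b s p j = b * p - gen_bid s j"

definition da_price :: "real \<Rightarrow> ('g::finite, 'l::finite) bids \<Rightarrow> real" where
  "da_price b s =
     ((\<Sum>l\<in>UNIV. load_bid s l) + (\<Sum>k\<in>UNIV. gen_bid s k)) / (b * real CARD('g))"

lemma da_clears_iff: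
  fixes s :: "('g::finite, 'l::finite) bids"
  assumes "b > 0"
  shows "(\<Sum>j\<in>UNIV. da_supply b s p j) = (\<Sum>l\<in>UNIV. load_bid s l) \<longleftrightarrow> p = da_price b s"
  using assms by (auto simp: da_supply_def da_price_def sum_subtractf field_simps)

definition da_dispatch :: "real \<Rightarrow> ('g::finite, 'l::finite) bids \<Rightarrow> 'g \<Rightarrow> real" where
  "da_dispatch b s j = da_supply b s (da_price b s) j"

definition rt_price :: "('g::finite \<Rightarrow> real) \<Rightarrow> ('l::finite \<Rightarrow> real) \<Rightarrow> real" where
  "rt_price c d = (\<Sum>l\<in>UNIV. d l) / (\<Sum>k\<in>UNIV. inverse (c k))"

text \<open>Mitigated supply: the real-time bid is replaced by the true marginal cost curve.\<close>

definition rt_supply ::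
  "real \<Rightarrow> ('g::finite \<Rightarrow> real) \<Rightarrow> ('g, 'l::finite) bids \<Rightarrow> real \<Rightarrow> 'g \<Rightarrow> real" where
  "rt_supply b c s p j = inverse (c j) * p - da_dispatch b s j"

definition rt_dispatch ::
  "real \<Rightarrow> ('g::finite \<Rightarrow> real) \<Rightarrow> ('l::finite \<Rightarrow> real) \<Rightarrow> ('g, 'l) bids \<Rightarrow> 'g \<Rightarrow> real" where
  "rt_dispatch b c d s j = rt_supply b c s (rt_price c d) j"

definition rt_demand :: "('l \<Rightarrow> real) \<Rightarrow> ('g, 'l) bids \<Rightarrow> 'l \<Rightarrow> real" where
  "rt_demand d s l = d l - load_bid s l"

lemma rt_clears_iff:
  fixes s :: "('g::finite, 'l::finite) bids"
  assumes "b > 0" and "\<And>j. c j > 0"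
  shows "(\<Sum>j\<in>UNIV. rt_supply b c s p j) = (\<Sum>l\<in>UNIV. rt_demand d s l) \<longleftrightarrow> p = rt_price c d"
proof -
  have pos: "(\<Sum>k\<in>UNIV. inverse (c k)) > 0"
    using assms(2) by (intro sum_pos) auto
  have "(\<Sum>j\<in>UNIV. da_dispatch b s j) = (\<Sum>l\<in>UNIV. load_bid s l)"
    unfolding da_dispatch_def using da_clears_iff[OF assms(1)] by blast
  moreover have "(\<Sum>j\<in>UNIV. inverse (c j) * p) = p * (\<Sum>k\<in>UNIV. inverse (c k))"
    by (simp add: sum_distrib_left mult.commute)
  ultimately have "(\<Sum>j\<in>UNIV. rt_supply b c s p j) = (\<Sum>l\<in>UNIV. rt_demand d s l)
      \<longleftrightarrow> p * (\<Sum>k\<in>UNIV. inverse (c k)) = (\<Sum>l\<in>UNIV. d l)"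
    by (simp add: rt_supply_def rt_demand_def sum_subtractf)
  then show ?thesis
    using pos by (simp add: rt_price_def nonzero_eq_divide_eq)
qed

definition gen_profit ::
  "real \<Rightarrow> ('g::finite \<Rightarrow> real) \<Rightarrow> ('l::finite \<Rightarrow> real) \<Rightarrow> ('g, 'l) bids \<Rightarrow> 'g \<Rightarrow> real" where
  "gen_profit b c d s j =
     rt_price c d * rt_dispatch b c d s j + da_price b s * da_dispatch b s j
     - c j / 2 * (da_dispatch b s j + rt_dispatch b c d s j)\<^sup>2"

definition load_payment ::
  "real \<Rightarrow> ('g::finite \<Rightarrow> real) \<Rightarrow> ('l::finite \<Rightarrow> real) \<Rightarrow> ('g, 'l) bids \<Rightarrow> 'l \<Rightarrow> real" where
  "load_payment b c d s l = da_price b s * load_bid s l + rt_price c d * rt_demand d s l"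

text \<open>
  Participants are price-anticipating: \<^const>\<open>da_price\<close> is re-evaluated at the deviating profile.
\<close>

definition two_stage_nash ::
  "real \<Rightarrow> ('g::finite \<Rightarrow> real) \<Rightarrow> ('l::finite \<Rightarrow> real) \<Rightarrow> ('g, 'l) bids \<Rightarrow> bool" where
  "two_stage_nash b c d s \<longleftrightarrow>
     (\<forall>j x. gen_profit b c d (s\<lparr>gen_bid := (gen_bid s)(j := x)\<rparr>) j \<le> gen_profit b c d s j) \<and>
     (\<forall>l y. load_payment b c d s l \<le> load_payment b c d (s\<lparr>load_bid := (load_bid s)(l := y)\<rparr>) l)"

end

theory Submission
  imports Defs
begin

text \<open>
  Mitigation fixes the total dispatch of generator \<open>j\<close> at \<open>\<lambda>\<^sup>r / c\<^sub>j\<close>, so the day-ahead game only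
  redistributes the spread \<open>\<mu> = \<lambda>\<^sup>d - \<lambda>\<^sup>r\<close>: generator \<open>j\<close> maximizes \<open>\<mu> g\<^sub>j\<^sup>d\<close>
  and load \<open>l\<close> minimizes \<open>\<mu> d\<^sub>l\<^sup>d\<close>. With \<open>N\<close> generators, the first-order conditions of these
  quadratic problems are \<open>g\<^sub>j\<^sup>d = b (N - 1) \<mu>\<close> and \<open>d\<^sub>l\<^sup>d = - b N \<mu>\<close>. Supply and demand thus
  respond to \<open>\<mu>\<close> with opposite signs, and day-ahead clearing forces \<open>\<mu> = 0\<close>.
\<close>

text \<open>A concave parabola through the origin has its maximum there exactly when its slope at 0
  vanishes. This makes first-order conditions both necessary and sufficient for best
  responses.\<close>

lemma quadratic_nonpos_iff:
  fixes a k :: real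
  assumes "k < 0"
  shows "(\<forall>t. a * t + k * t\<^sup>2 \<le> 0) \<longleftrightarrow> a = 0"
proof
  assume "\<forall>t. a * t + k * t\<^sup>2 \<le> 0"
  \<comment> \<open>The test point is the vertex, where the value is positive unless
    \<open>a = 0\<close>.\<close>
  then have "a * (- a / (2 * k)) + k * (- a / (2 * k))\<^sup>2 \<le> 0" by blast
  also have "a * (- a / (2 * k)) + k * (- a / (2 * k))\<^sup>2 = - (a\<^sup>2 / (4 * k))"
    using assms by (simp add: field_simps power2_eq_square)
  finally show "a = 0"
    using assms by (auto simp: zero_le_divide_iff)
next
  assume "a = 0"
  then show "\<forall>t. a * t + k * t\<^sup>2 \<le> 0"
    using assms by (simp add: mult_nonpos_nonneg)
qed

lemma sum_fun_upd:
  fixes f :: "'a::finite \<Rightarrow> 'b::ab_group_add"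
  shows "(\<Sum>i\<in>UNIV. (f(j := x)) i) = (\<Sum>i\<in>UNIV. f i) + (x - f j)"
proof -
  have "(\<Sum>i\<in>UNIV. (f(j := x)) i) = x + (\<Sum>i\<in>UNIV - {j}. f i)"
    by (subst sum.remove[of _ j]) (auto intro: sum.cong)
  moreover have "(\<Sum>i\<in>UNIV. f i) = f j + (\<Sum>i\<in>UNIV - {j}. f i)"
    by (subst sum.remove[of _ j]) auto
  ultimately show ?thesis by simp
qed

lemma da_price_gen_deviation:
  fixes s :: "('g::finite, 'l::finite) bids"
  shows "da_price b (s\<lparr>gen_bid := (gen_bid s)(j := x)\<rparr>)
    = da_price b s + (x - gen_bid s j) / (b * real CARD('g))"
  by (simp add: da_price_def sum_fun_upd add_divide_distrib diff_divide_distrib del: fun_upd_apply)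

lemma da_price_load_deviation:
  fixes s :: "('g::finite, 'l::finite) bids"
  shows "da_price b (s\<lparr>load_bid := (load_bid s)(l := y)\<rparr>)
    = da_price b s + (y - load_bid s l) / (b * real CARD('g))"
  by (simp add: da_price_def sum_fun_upd add_divide_distrib diff_divide_distrib del: fun_upd_apply)

text \<open>The day-ahead dispatch cancels from the total, so the cost is constant. The last bracket
  is independent of \<open>s\<close> and drops out when profiles are compared.\<close>

lemma gen_profit_eq:
  fixes s :: "('g::finite, 'l::finite) bids"
  shows "gen_profit b c d s j =
    (da_price b s - rt_price c d) * da_dispatch b s j
    + (rt_price c d * (inverse (c j) * rt_price c d) - c j / 2 * (inverse (c j) * rt_price c d)\<^sup>2)"
  by (simp add: gen_profit_def rt_dispatch_def rt_supply_def algebra_simps)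

lemma load_payment_eq:
  "load_payment b c d s l = (da_price b s - rt_price c d) * load_bid s l + rt_price c d * d l"
  by (simp add: load_payment_def rt_demand_def algebra_simps)

lemma generator_best_response_iff:
  fixes s :: "('g::finite, 'l::finite) bids"
  assumes "b > 0" and "CARD('g) > 1"
  shows "(\<forall>x. gen_profit b c d (s\<lparr>gen_bid := (gen_bid s)(j := x)\<rparr>) j \<le> gen_profit b c d s j)
    \<longleftrightarrow> da_dispatch b s j = b * (real CARD('g) - 1) * (da_price b s - rt_price c d)"
    (is "(\<forall>x. ?P x) \<longleftrightarrow> ?R")
proof -
  define N where "N = real CARD('g)"
  define \<mu> where "\<mu> = da_price b s - rt_price c d"
  define g where "g = da_dispatch b s j"
  have N: "N > 1" using assms(2) by (simp add: N_def)
  \<comment> \<open>\<open>a\<close> and \<open>k\<close> are the coefficients of the profit gain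
    when generator \<open>j\<close> raises its bid by \<open>t\<close>. With a single generator,
    \<open>k\<close> would be 0 and the gain linear in \<open>t\<close>.\<close>
  define a where "a = g / (b * N) - \<mu> * ((N - 1) / N)"
  define k where "k = - ((N - 1) / N / (b * N))"
  have k: "k < 0" using N assms(1) by (simp add: k_def)
  have diff: "gen_profit b c d (s\<lparr>gen_bid := (gen_bid s)(j := gen_bid s j + t)\<rparr>) j
      - gen_profit b c d s j = a * t + k * t\<^sup>2" for t
  proof -
    let ?s = "s\<lparr>gen_bid := (gen_bid s)(j := gen_bid s j + t)\<rparr>"
    have price: "da_price b ?s = da_price b s + t / (b * N)"
      by (simp add: da_price_gen_deviation N_def del: fun_upd_apply)
    \<comment> \<open>Bidding \<open>t\<close> more withdraws \<open>t\<close> units, but the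
      induced price rise restores \<open>t / N\<close> of them.\<close>
    have dispatch: "da_dispatch b ?s j = g - (N - 1) / N * t"
      unfolding da_dispatch_def da_supply_def price g_def
      using assms(1) N by (simp add: field_simps)
    have "gen_profit b c d ?s j - gen_profit b c d s j
        = (\<mu> + t / (b * N)) * (g - (N - 1) / N * t) - \<mu> * g"
      unfolding gen_profit_eq price dispatch by (simp add: \<mu>_def g_def)
    also have "\<dots> = a * t + k * t\<^sup>2"
      by (simp add: a_def k_def algebra_simps add_divide_distrib diff_divide_distrib power2_eq_square)
    finally show ?thesis .
  qed
  have "(\<forall>x. ?P x) \<longleftrightarrow> (\<forall>t. ?P (gen_bid s j + t))"
    by (metis add_diff_cancel_left' diff_add_cancel add.commute)
  also have "\<dots> \<longleftrightarrow> (\<forall>t. a * t + k * t\<^sup>2 \<le> 0)"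
    by (simp flip: diff)
  also have "\<dots> \<longleftrightarrow> a = 0" by (rule quadratic_nonpos_iff[OF k])
  also have "\<dots> \<longleftrightarrow> g = b * (N - 1) * \<mu>"
    using assms(1) N by (simp add: a_def field_simps)
  finally show ?thesis by (simp add: g_def N_def \<mu>_def)
qed

lemma load_best_response_iff:
  fixes s :: "('g::finite, 'l::finite) bids"
  assumes "b > 0"
  shows "(\<forall>y. load_payment b c d s l \<le> load_payment b c d (s\<lparr>load_bid := (load_bid s)(l := y)\<rparr>) l)
    \<longleftrightarrow> load_bid s l = - (b * real CARD('g) * (da_price b s - rt_price c d))"
    (is "(\<forall>y. ?P y) \<longleftrightarrow> ?R")
proof -
  define N where "N = real CARD('g)"
  define \<mu> where "\<mu> = da_price b s - rt_price c d"
  define q where "q = load_bid s l"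
  have N: "N > 0" by (simp add: N_def)
  define a where "a = - \<mu> - q / (b * N)"
  define k where "k = - (1 / (b * N))"
  have k: "k < 0" using N assms by (simp add: k_def)
  \<comment> \<open>The payment saved, old minus new, is concave in \<open>t\<close>, so minimizing
    payments falls under the same lemma as maximizing profits.\<close>
  have diff: "load_payment b c d s l
      - load_payment b c d (s\<lparr>load_bid := (load_bid s)(l := load_bid s l + t)\<rparr>) l
      = a * t + k * t\<^sup>2" for t
  proof -
    let ?s = "s\<lparr>load_bid := (load_bid s)(l := load_bid s l + t)\<rparr>"
    have "da_price b ?s = da_price b s + t / (b * N)"
      by (simp add: da_price_load_deviation N_def del: fun_upd_apply)
    then have "load_payment b c d s l - load_payment b c d ?s l
        = \<mu> * q - (\<mu> + t / (b * N)) * (q + t)"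
      by (simp add: load_payment_eq \<mu>_def q_def algebra_simps)
    also have "\<dots> = a * t + k * t\<^sup>2"
      by (simp add: a_def k_def algebra_simps add_divide_distrib power2_eq_square)
    finally show ?thesis .
  qed
  have "(\<forall>y. ?P y) \<longleftrightarrow> (\<forall>t. ?P (load_bid s l + t))"
    by (metis add_diff_cancel_left' diff_add_cancel add.commute)
  also have "\<dots> \<longleftrightarrow> (\<forall>t. a * t + k * t\<^sup>2 \<le> 0)"
    by (simp flip: diff)
  also have "\<dots> \<longleftrightarrow> a = 0" by (rule quadratic_nonpos_iff[OF k])
  also have "\<dots> \<longleftrightarrow> q = - (b * N * \<mu>)"
    using assms N by (auto simp: a_def field_simps)
  finally show ?thesis by (simp add: q_def N_def \<mu>_def)
qed

lemma two_stage_nash_iff: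
  fixes s :: "('g::finite, 'l::finite) bids"
  assumes b: "b > 0" and card: "CARD('g) > 1"
  shows "two_stage_nash b c d s \<longleftrightarrow>
    (\<forall>j. gen_bid s j = b * rt_price c d) \<and> (\<forall>l. load_bid s l = 0)"
proof -
  define N where "N = real CARD('g)"
  define L where "L = real CARD('l)"
  define \<mu> where "\<mu> = da_price b s - rt_price c d"
  have N: "N > 1" and L: "L > 0" using card by (simp_all add: N_def L_def)
  have nash: "two_stage_nash b c d s \<longleftrightarrow>
      (\<forall>j. da_dispatch b s j = b * (N - 1) * \<mu>) \<and> (\<forall>l. load_bid s l = - (b * N * \<mu>))"
    unfolding two_stage_nash_def N_def \<mu>_def
    using generator_best_response_iff[OF b card] load_best_response_iff[OF b] by blast
  show ?thesis
  proof
    assume "two_stage_nash b c d s"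
    with nash have gen: "\<And>j. da_dispatch b s j = b * (N - 1) * \<mu>"
      and load: "\<And>l. load_bid s l = - (b * N * \<mu>)" by auto
    have "(\<Sum>j\<in>UNIV. da_dispatch b s j) = (\<Sum>l\<in>UNIV. load_bid s l)"
      unfolding da_dispatch_def using da_clears_iff[OF b] by blast
    \<comment> \<open>Summing the best responses over each side of the market turns clearing into
      one linear equation in the spread. Its coefficient \<open>b * N * (N - 1 + L)\<close> is
      positive.\<close>
    then have "N * (b * (N - 1) * \<mu>) = L * - (b * N * \<mu>)"
      by (simp add: gen load N_def L_def)
    then have "b * N * (N - 1 + L) * \<mu> = 0" by (simp add: algebra_simps)
    then have "\<mu> = 0" using b N L by auto
    then show "(\<forall>j. gen_bid s j = b * rt_price c d) \<and> (\<forall>l. load_bid s l = 0)"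
      using gen load by (simp add: da_dispatch_def da_supply_def \<mu>_def)
  next
    assume bids: "(\<forall>j. gen_bid s j = b * rt_price c d) \<and> (\<forall>l. load_bid s l = 0)"
    \<comment> \<open>At these bids the spread and all day-ahead quantities vanish, so every
      first-order condition reads 0 = 0.\<close>
    then have "da_price b s = rt_price c d" using b by (simp add: da_price_def)
    then show "two_stage_nash b c d s"
      using bids by (simp add: nash \<mu>_def da_dispatch_def da_supply_def)
  qed
qed

theorem theorem5:
  fixes b :: real and c :: "'g::finite \<Rightarrow> real" and d :: "'l::finite \<Rightarrow> real"
  assumes "b > 0"
    and "\<And>j. c j > 0"
    and "\<And>l. d l > 0"
    and "CARD('g) > 1"
  shows "(\<exists>!s :: ('g, 'l) bids. two_stage_nash b c d s) \<and>
    (\<forall>s :: ('g, 'l) bids. two_stage_nash b c d s \<longrightarrow>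
      (\<forall>j. da_dispatch b s j = 0 \<and>
           rt_dispatch b c d s j = inverse (c j) / (\<Sum>k\<in>UNIV. inverse (c k)) * (\<Sum>l\<in>UNIV. d l) \<and>
           gen_bid s j = b / (\<Sum>k\<in>UNIV. inverse (c k)) * (\<Sum>l\<in>UNIV. d l)) \<and>
      (\<forall>l. load_bid s l = 0 \<and> rt_demand d s l = d l) \<and>
      da_price b s = rt_price c d \<and>
      rt_price c d = (\<Sum>l\<in>UNIV. d l) / (\<Sum>k\<in>UNIV. inverse (c k)))"
proof -
  have nash: "two_stage_nash b c d s \<longleftrightarrow>
      (\<forall>j. gen_bid s j = b * rt_price c d) \<and> (\<forall>l. load_bid s l = 0)" for s :: "('g, 'l) bids"
    by (rule two_stage_nash_iff[OF assms(1,4)])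
  have "\<exists>!s :: ('g, 'l) bids. two_stage_nash b c d s"
  proof
    show "two_stage_nash b c d
        (\<lparr>gen_bid = \<lambda>_. b * rt_price c d, load_bid = \<lambda>_. 0\<rparr> :: ('g, 'l) bids)"
      by (simp add: nash)
  next
    fix s :: "('g, 'l) bids"
    assume "two_stage_nash b c d s"
    then show "s = \<lparr>gen_bid = \<lambda>_. b * rt_price c d, load_bid = \<lambda>_. 0\<rparr>"
      by (intro bids.equality) (auto simp: nash)
  qed
  moreover have "da_price b s = rt_price c d" if "two_stage_nash b c d s" for s :: "('g, 'l) bids"
    using that assms(1) by (simp add: nash da_price_def)
  ultimately show ?thesis
    by (auto simp: nash da_dispatch_def da_supply_def rt_dispatch_def rt_supply_def
        rt_demand_def rt_price_def)
qed

end
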